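(* Let $X$ be a separable infinite-dimensional Fréchet space over $\mathbb{K}$, where $\mathbb{K}=\mathbb{R}$ or $\mathbb{C}$, and let $T:X\to X$ be a continuous linear operator. If $T$ is chaotic, then $T$ is reiteratively hypercyclic.
   Context: Let $T$ be a continuous linear operator on a separable infinite-dimensional Fréchet space $X$. For $x\in X$ and $U\subset X$, the return set is $N(x,U):=\{n\ge 0: T^n x\in U\}$. $T$ is hypercyclic if there exists $x\in X$ whose orbit $\{T^n x: n\ge 0\}$ is dense in $X$. A vector $x\in X$ is periodic for $T$ if there exists an integer $N>0$ such that $T^N x=x$. $T$ is chaotic (in the sense of Devaney) if $T$ is hypercyclic and the set of periodic vectors of $T$ is dense in $X$. For a set $A$ of non-negative integers, the upper Banach density of $A$ is $$\overline{\mathrm{Bd}}(A):=\lim_{N\to\infty}\frac{a_N}{N},\qquad a_N:=\limsup_{k\to\infty}\#\big(A\cap[k+1,k+N]\big).$$ $T$ is reiteratively hypercyclic if there exists a vector $x\in X$ such that for every non-empty open set $U\subset X$ one has $\overline{\mathrm{Bd}}(N(x,U))>0$. *)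

theory Defs
  imports "HOL-Analysis.Analysis"
begin

definition seminorm :: "('k::real_normed_field \<Rightarrow> 'a::ab_group_add \<Rightarrow> 'a) \<Rightarrow> ('a \<Rightarrow> real) \<Rightarrow> bool"
  where "seminorm sc p \<longleftrightarrow>
    (\<forall>x. 0 \<le> p x) \<and>
    (\<forall>c x. p (sc c x) = norm c * p x) \<and>
    (\<forall>x y. p (x + y) \<le> p x + p y)"

text \<open>
  The scalar field is a type parameter, so that real and complex spaces are treated alike; in
  the complex case the vectors carry a scalar multiplication by complex numbers.
  The seminorms are not assumed to increase with the index, so a basic neighbourhood of a point
  is given by finitely many of them. Completeness may be expressed by sequences, because
  countably many seminorms induce a (pseudo)metrizable topology.
\<close>

locale frechet_space = vector_space sc
  for sc :: "'k::real_normed_field \<Rightarrow> 'a::{ab_group_add, topological_space} \<Rightarrow> 'a" +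
  assumes complete_countable_seminorms:
    "\<exists>p :: nat \<Rightarrow> 'a \<Rightarrow> real.
       (\<forall>n. seminorm sc (p n)) \<and>
       (\<forall>x. x \<noteq> 0 \<longrightarrow> (\<exists>n. p n x \<noteq> 0)) \<and>
       (\<forall>U. open U \<longleftrightarrow>
          (\<forall>x\<in>U. \<exists>n. \<exists>e>0. \<forall>y. (\<forall>m\<le>n. p m (y - x) < e) \<longrightarrow> y \<in> U)) \<and>
       (\<forall>u :: nat \<Rightarrow> 'a.
          (\<forall>n. \<forall>e>0. \<exists>M. \<forall>i\<ge>M. \<forall>j\<ge>M. p n (u i - u j) < e) \<longrightarrow> (\<exists>l. u \<longlonglongrightarrow> l))"

locale separable_infinite_dimensional_frechet_space = frechet_space sc
  for sc :: "'k::real_normed_field \<Rightarrow> 'a::{ab_group_add, topological_space} \<Rightarrow> 'a" +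
  assumes separable: "separable_space (euclidean :: 'a topology)"
    and infinite_dimensional: "\<nexists>B. finite B \<and> span B = UNIV"

definition return_set :: "('a \<Rightarrow> 'a) \<Rightarrow> 'a \<Rightarrow> 'a set \<Rightarrow> nat set"
  where "return_set T x U = {n. (T ^^ n) x \<in> U}"

definition hypercyclic :: "('a::topological_space \<Rightarrow> 'a) \<Rightarrow> bool"
  where "hypercyclic T \<longleftrightarrow> (\<exists>x. closure {(T ^^ n) x | n. True} = UNIV)"

definition periodic_vector :: "('a \<Rightarrow> 'a) \<Rightarrow> 'a \<Rightarrow> bool"
  where "periodic_vector T x \<longleftrightarrow> (\<exists>N>0. (T ^^ N) x = x)"

definition chaotic :: "('a::topological_space \<Rightarrow> 'a) \<Rightarrow> bool"
  where "chaotic T \<longleftrightarrow> hypercyclic T \<and> closure {x. periodic_vector T x} = UNIV"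

text \<open>
  Extended reals are used only because \<^const>\<open>limsup\<close> needs a complete lattice: every density lies
  between 0 and 1. The limit always exists, since the inner limit superior is subadditive in
  \<open>N\<close>; the term for \<open>N = 0\<close> plays no role.
\<close>

definition upper_Banach_density :: "nat set \<Rightarrow> ereal"
  where "upper_Banach_density A =
    lim (\<lambda>N::nat. limsup (\<lambda>k::nat. ereal (real (card (A \<inter> {k + 1..k + N})))) / ereal (real N))"

definition reiteratively_hypercyclic :: "('a::topological_space \<Rightarrow> 'a) \<Rightarrow> bool"
  where "reiteratively_hypercyclic T \<longleftrightarrow>
    (\<exists>x. \<forall>U. open U \<and> U \<noteq> {} \<longrightarrow> upper_Banach_density (return_set T x U) > 0)"

end

theory Submission
  imports Defs
begin

text \<open>
  The vector that works is any hypercyclic vector \<open>x\<close>. Given a nonempty open \<open>U\<close>, pick a periodic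
  point \<open>p \<in> U\<close>, of period \<open>d\<close>. By continuity every orbit that comes close enough to \<open>p\<close> shadows the
  orbit of \<open>p\<close> for as long as desired, hence visits \<open>U\<close> once every \<open>d\<close> steps during that time. Since
  the orbit of \<open>x\<close> is dense, it does come that close to \<open>p\<close>, so \<open>N(x,U)\<close> contains arbitrarily long
  arithmetic progressions of difference \<open>d\<close>, and discarding the beginnings of longer ones puts
  them arbitrarily far out (\<open>return_set_progressions\<close>). Hence windows of length \<open>N\<close> containing at
  least \<open>N div d\<close> elements of \<open>N(x,U)\<close> occur arbitrarily far out, so that the upper Banach density
  is at least \<open>1 / (2 * d)\<close> (\<open>upper_Banach_density_pos_of_progressions\<close>).

  The density is defined by \<^const>\<open>lim\<close>, about which nothing can be said until the limit is known to
  exist. The limit superior of the window counts is subadditive in the length of the window, and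
  Fekete's lemma (\<open>fekete_nonneg\<close>) provides the limit.
\<close>

section \<open>Existence of the upper Banach density\<close>

lemma subadditive_mult_add_le:
  fixes b :: "nat \<Rightarrow> real"
  assumes "\<And>m n. b (m + n) \<le> b m + b n"
  shows "b (q * m + r) \<le> real q * b m + b r"
proof (induction q)
  case (Suc q)
  have "b (Suc q * m + r) = b (m + (q * m + r))"
    by (simp add: add.assoc)
  also have "\<dots> \<le> b m + b (q * m + r)"
    by (rule assms)
  finally show ?case
    using Suc by (simp add: algebra_simps)
qed simp

text \<open>
  Fekete's lemma: a value \<open>b m / m\<close> close to the infimum governs all large \<open>n\<close>, because cutting
  \<open>n\<close> into blocks of length \<open>m\<close> costs only the bounded contribution of the remainder.
\<close>

lemma fekete_nonneg:
  fixes b :: "nat \<Rightarrow> real"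
  assumes sub: "\<And>m n. b (m + n) \<le> b m + b n" and nonneg: "\<And>n. 0 \<le> b n"
  shows "(\<lambda>n. b n / real n) \<longlonglongrightarrow> (INF n\<in>{1..}. b n / real n)"
proof -
  define L where "L = (INF n\<in>{1..}. b n / real n)"
  have bdd: "bdd_below ((\<lambda>n. b n / real n) ` {1..})"
    by (rule bdd_belowI[of _ 0]) (auto simp: nonneg)
  have "(\<lambda>n. b n / real n) \<longlonglongrightarrow> L"
  proof (rule order_tendstoI)
    fix a assume "a < L"
    have "L \<le> b n / real n" if "1 \<le> n" for n
      unfolding L_def using that bdd by (intro cINF_lower) auto
    then show "\<forall>\<^sub>F n in sequentially. a < b n / real n"
      using \<open>a < L\<close> by (intro eventually_sequentiallyI[of 1]) (auto intro: less_le_trans)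
  next
    fix a assume "L < a"
    then obtain m where m: "1 \<le> m" "b m / real m < a"
      unfolding L_def using cInf_lessD[of "(\<lambda>n. b n / real n) ` {1..}" a] by auto
    define C where "C = Max (b ` {..<m})"
    have C: "b r \<le> C" if "r < m" for r
      unfolding C_def using that by (intro Max_ge) auto
    have le: "b n / real n \<le> b m / real m + C / real n" if "1 \<le> n" for n
    proof -
      have "b n \<le> real (n div m) * b m + b (n mod m)"
        using subadditive_mult_add_le[of b "n div m" m "n mod m", OF sub] by simp
      also have "\<dots> \<le> (real n / real m) * b m + C"
        using m by (intro add_mono mult_right_mono of_nat_div_le_of_nat C nonneg) auto
      finally show ?thesis
        using that m by (simp add: field_simps)
    qed
    have "(\<lambda>n. b m / real m + C / real n) \<longlonglongrightarrow> b m / real m + 0"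
      by (intro tendsto_add tendsto_const lim_const_over_n)
    then have "\<forall>\<^sub>F n in sequentially. b m / real m + C / real n < a"
      using m by (intro order_tendstoD(2)) auto
    then show "\<forall>\<^sub>F n in sequentially. b n / real n < a"
      using eventually_ge_at_top[of 1] by eventually_elim (use le in fastforce)
  qed
  then show ?thesis
    by (simp add: L_def)
qed

definition window_count :: "nat set \<Rightarrow> nat \<Rightarrow> nat \<Rightarrow> ereal"
  where "window_count A N k = ereal (real (card (A \<inter> {k + 1..k + N})))"

lemma limsup_window_count_bounds:
  "0 \<le> limsup (window_count A N)" "limsup (window_count A N) \<le> ereal (real N)"
proof -
  show "0 \<le> limsup (window_count A N)"
    by (rule le_Limsup) (auto simp: window_count_def)
  have "card (A \<inter> {k + 1..k + N}) \<le> N" for k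
    using card_mono[of "{k + 1..k + N}" "A \<inter> {k + 1..k + N}"] by simp
  then show "limsup (window_count A N) \<le> ereal (real N)"
    by (intro Limsup_bounded) (simp add: window_count_def)
qed

text \<open>
  A window of length \<open>M + N\<close> splits into two, and the shift of the second one by \<open>M\<close> is
  invisible to the limit superior.
\<close>

lemma limsup_window_count_subadditive:
  "limsup (window_count A (M + N)) \<le> limsup (window_count A M) + limsup (window_count A N)"
proof -
  have "window_count A (M + N) k \<le> window_count A M k + window_count A N (k + M)" for k
  proof -
    have "A \<inter> {k + 1..k + (M + N)}
        = (A \<inter> {k + 1..k + M}) \<union> (A \<inter> {k + M + 1..k + M + N})"
      by auto
    then have "card (A \<inter> {k + 1..k + (M + N)})
        \<le> card (A \<inter> {k + 1..k + M}) + card (A \<inter> {k + M + 1..k + M + N})"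
      by (metis card_Un_le)
    then show ?thesis
      by (simp add: window_count_def flip: of_nat_add)
  qed
  then have "limsup (window_count A (M + N))
      \<le> limsup (\<lambda>k. window_count A M k + window_count A N (k + M))"
    by (intro Limsup_mono) simp
  also have "\<dots> \<le> limsup (window_count A M) + limsup (\<lambda>k. window_count A N (k + M))"
    by (rule ereal_limsup_add_mono)
  also have "limsup (\<lambda>k. window_count A N (k + M)) = limsup (window_count A N)"
    by (rule limsup_shift_k)
  finally show ?thesis .
qed

lemma upper_Banach_density_limit:
  "(\<lambda>N. limsup (window_count A N) / ereal (real N)) \<longlonglongrightarrow> upper_Banach_density A"
proof -
  define b where "b N = real_of_ereal (limsup (window_count A N))" for N
  have fin: "\<bar>limsup (window_count A N)\<bar> \<noteq> \<infinity>" for N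
    using limsup_window_count_bounds[where A = A and N = N] by auto
  have b: "limsup (window_count A N) = ereal (b N)" for N
    using fin by (simp add: b_def ereal_real')
  have "(\<lambda>N. b N / real N) \<longlonglongrightarrow> (INF N\<in>{1..}. b N / real N)"
  proof (rule fekete_nonneg)
    show "b (M + N) \<le> b M + b N" for M N
      using limsup_window_count_subadditive[of A M N] by (simp add: b)
    show "0 \<le> b N" for N
      using limsup_window_count_bounds(1)[of A N] by (simp add: b)
  qed
  then have "(\<lambda>N. ereal (b N / real N)) \<longlonglongrightarrow> ereal (INF N\<in>{1..}. b N / real N)"
    by (rule tendsto_ereal)
  then have lim: "(\<lambda>N. limsup (window_count A N) / ereal (real N))
      \<longlonglongrightarrow> ereal (INF N\<in>{1..}. b N / real N)"
    by (rule Lim_transform_eventually)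
       (auto simp: b eventually_sequentially intro!: exI[of _ 1])
  moreover have "upper_Banach_density A = lim (\<lambda>N. limsup (window_count A N) / ereal (real N))"
    by (simp add: upper_Banach_density_def window_count_def[abs_def])
  ultimately show ?thesis
    by (simp add: limI)
qed

section \<open>Arithmetic progressions and positive density\<close>

lemma upper_Banach_density_pos_of_progressions:
  assumes "d > 0"
    and prog: "\<And>N K. \<exists>k\<ge>K. \<forall>j\<le>N. k + j * d \<in> A"
  shows "upper_Banach_density A > 0"
proof -
  have count: "ereal (real (N div d)) \<le> limsup (window_count A N)" for N
  proof (rule ccontr)
    assume "\<not> ?thesis"
    then have "\<forall>\<^sub>F k in sequentially. window_count A N k < ereal (real (N div d))"
      by (intro Limsup_lessD) simp
    then obtain K where K: "\<And>k. k \<ge> K \<Longrightarrow> window_count A N k < ereal (real (N div d))"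
      by (auto simp: eventually_sequentially)
    obtain k where k: "k \<ge> K" "\<And>j. j \<le> N div d \<Longrightarrow> k + j * d \<in> A"
      using prog by blast
    \<comment> \<open>The window starts at \<open>k + 1\<close>, so the term \<open>j = 0\<close> of the progression does not count.\<close>
    have "(\<lambda>j. k + j * d) ` {1..N div d} \<subseteq> A \<inter> {k + 1..k + N}"
    proof safe
      fix j assume "j \<in> {1..N div d}"
      then have "j * d \<le> N" "1 \<le> j * d"
        using \<open>d > 0\<close> by (auto simp: less_eq_div_iff_mult_less_eq Suc_le_eq)
      then show "k + j * d \<in> {k + 1..k + N}"
        by simp
    qed (use k in auto)
    then have "card ((\<lambda>j. k + j * d) ` {1..N div d}) \<le> card (A \<inter> {k + 1..k + N})"
      by (intro card_mono) auto
    moreover have "card ((\<lambda>j. k + j * d) ` {1..N div d}) = N div d"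
      using \<open>d > 0\<close> by (subst card_image) (auto simp: inj_on_def)
    ultimately show False
      using K[OF k(1)] by (simp add: window_count_def)
  qed
  have "ereal (1 / (2 * real d)) \<le> limsup (window_count A N) / ereal (real N)" if "N \<ge> d" for N
  proof -
    \<comment> \<open>As \<open>N div d \<ge> 1\<close>, rounding down at most halves the quotient.\<close>
    have "1 * d \<le> N div d * d"
      using that \<open>d > 0\<close> by (intro mult_right_mono) (auto simp: less_eq_div_iff_mult_less_eq)
    moreover have "N = N div d * d + N mod d" "N mod d < d"
      using \<open>d > 0\<close> by auto
    ultimately have "N \<le> 2 * (N div d * d)"
      by linarith
    then have "real N \<le> 2 * (real (N div d) * real d)"
      by (metis of_nat_le_iff of_nat_mult of_nat_numeral)
    then have "1 / (2 * real d) \<le> real (N div d) / real N"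
      using that \<open>d > 0\<close> by (simp add: field_simps)
    then have "ereal (1 / (2 * real d)) \<le> ereal (real (N div d)) / ereal (real N)"
      using that \<open>d > 0\<close> by simp
    also have "\<dots> \<le> limsup (window_count A N) / ereal (real N)"
      using that \<open>d > 0\<close> by (intro ereal_divide_right_mono count) auto
    finally show ?thesis .
  qed
  then have "ereal (1 / (2 * real d)) \<le> upper_Banach_density A"
    by (intro tendsto_lowerbound[OF upper_Banach_density_limit])
       (auto intro: eventually_sequentiallyI[of d])
  moreover have "0 < ereal (1 / (2 * real d))"
    using \<open>d > 0\<close> by simp
  ultimately show ?thesis
    by (rule less_le_trans[rotated])
qed

section \<open>Dense orbits shadow periodic orbits\<close>

lemma continuous_on_funpow_UNIV:
  fixes T :: "'a::topological_space \<Rightarrow> 'a"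
  assumes "continuous_on UNIV T"
  shows "continuous_on UNIV (T ^^ n)"
proof (induction n)
  case (Suc n)
  then show ?case
    using continuous_on_compose[of UNIV "T ^^ n" T]
      continuous_on_subset[OF assms, of "range (T ^^ n)"]
    by simp
qed (simp add: id_def continuous_on_id)

lemma funpow_mult_fixpoint:
  assumes "(T ^^ d) p = p"
  shows "(T ^^ (j * d)) p = p"
  using assms by (induction j) (auto simp: funpow_add)

text \<open>
  The points whose iterates of order \<open>0, d, 2d, \<dots>, (K + N)d\<close> all lie in \<open>U\<close> form an open
  neighbourhood of \<open>p\<close>, which a dense orbit must enter. Dropping the first \<open>K\<close> terms of the
  resulting progression makes it start beyond \<open>K\<close>, even if that neighbourhood is visited only
  once.
\<close>

lemma return_set_progressions:
  fixes T :: "'a::topological_space \<Rightarrow> 'a"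
  assumes cont: "continuous_on UNIV T"
    and dense: "closure {(T ^^ n) x | n. True} = UNIV"
    and U: "open U" "p \<in> U"
    and d: "d > 0" "(T ^^ d) p = p"
  shows "\<exists>k\<ge>K. \<forall>j\<le>N. k + j * d \<in> return_set T x U"
proof -
  define V where "V = (\<Inter>j\<in>{..K + N}. (T ^^ (j * d)) -` U)"
  have "open V"
    unfolding V_def using U
    by (intro open_INT ballI open_vimage continuous_on_funpow_UNIV[OF cont]) auto
  moreover have "p \<in> V"
    using U funpow_mult_fixpoint[OF d(2)] by (auto simp: V_def)
  ultimately have "V \<inter> {(T ^^ n) x | n. True} \<noteq> {}"
    using dense by (metis IntI UNIV_I empty_iff open_Int_closure_eq_empty)
  then obtain n where n: "(T ^^ n) x \<in> V"
    by auto
  have "n + K * d + j * d \<in> return_set T x U" if "j \<le> N" for j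
  proof -
    have "(T ^^ ((K + j) * d)) ((T ^^ n) x) \<in> U"
      using n that by (auto simp: V_def)
    then have "(T ^^ ((K + j) * d + n)) x \<in> U"
      by (simp add: funpow_add)
    moreover have "(K + j) * d + n = n + K * d + j * d"
      by (simp add: algebra_simps)
    ultimately show ?thesis
      unfolding return_set_def by (metis mem_Collect_eq)
  qed
  moreover have "K \<le> n + K * d"
    using d(1) by (simp add: trans_le_add2)
  ultimately show ?thesis
    by blast
qed

theorem chaotic_imp_reiteratively_hypercyclic:
  fixes T :: "'a::topological_space \<Rightarrow> 'a"
  assumes cont: "continuous_on UNIV T" and "chaotic T"
  shows "reiteratively_hypercyclic T"
proof -
  obtain x where x: "closure {(T ^^ n) x | n. True} = UNIV"
    using \<open>chaotic T\<close> by (auto simp: chaotic_def hypercyclic_def)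
  have "upper_Banach_density (return_set T x U) > 0" if U: "open U" "U \<noteq> {}" for U
  proof -
    have "U \<inter> {p. periodic_vector T p} \<noteq> {}"
      using \<open>chaotic T\<close> U open_Int_closure_eq_empty[of U "{p. periodic_vector T p}"]
      by (simp add: chaotic_def)
    then obtain p d where "p \<in> U" "d > 0" "(T ^^ d) p = p"
      by (auto simp: periodic_vector_def)
    then show ?thesis
      using upper_Banach_density_pos_of_progressions return_set_progressions[OF cont x U(1)]
      by metis
  qed
  then show ?thesis
    by (auto simp: reiteratively_hypercyclic_def)
qed

theorem theorem1p1:
  fixes T :: "'a::{ab_group_add, topological_space} \<Rightarrow> 'a"
  assumes "(\<exists>sc :: real \<Rightarrow> 'a \<Rightarrow> 'a.
              separable_infinite_dimensional_frechet_space sc \<and> Vector_Spaces.linear sc sc T) \<or>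
           (\<exists>sc :: complex \<Rightarrow> 'a \<Rightarrow> 'a.
              separable_infinite_dimensional_frechet_space sc \<and> Vector_Spaces.linear sc sc T)"
    and "continuous_on UNIV T"
    and "chaotic T"
  shows "reiteratively_hypercyclic T"
  using assms(2,3) by (rule chaotic_imp_reiteratively_hypercyclic)

end
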